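(* Let $\eta_0,\eta_1,\eta_2,\eta_3,\eta_4$ be parameters with $\eta_4\ne0$, and let $J_0,J_\pm$ be the generators of $\mathfrak{sl}_2$ with Casimir element $C=J_0^2-J_0+J_+J_-$. Put $$Z=J_+-\mathcal I,\qquad X=-J_0J_++J_0+\xi_1J_++\xi_0\mathcal I,\qquad V=\xi_2J_0^2+\xi_3J_0+\xi_4J_-+\xi_5\mathcal I,$$ with $$\xi_0=\frac{\eta_1-\eta_3}{\eta_4},\quad \xi_2=\xi_4=-\frac{\eta_4}{2},\quad \xi_3=\eta_1+\eta_4\left(\xi_1-\tfrac12\right),\quad \xi_5=\tfrac12\left(\eta_4(\xi_1-\xi_1^2)+\eta_1(1-2\xi_1)-\eta_2\right),$$ and $\xi_1$ a root of the quadratic equation $$-\eta_4^2\xi_1^2+\eta_4(\eta_4-2\eta_1)\xi_1-2\eta_1^2+2\eta_1\eta_3-2\eta_0\eta_4+\eta_4\eta_1+\eta_2\eta_4+\eta_4^2\,C=0 .$$ Then these formulas provide an embedding of the following algebra into $\mathcal U(\mathfrak{sl}_2)$, i.e. they satisfy $$[Z,X]=Z^2+Z,$$ $$[X,V]=\{V,Z\}+\eta_1X+V+\eta_2Z+\eta_0\mathcal I,$$ $$[V,Z]=\eta_4X+\eta_1Z+\eta_3\mathcal I .$$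
   Context: $[A,B]=AB-BA$, $\{A,B\}=AB+BA$, $\mathcal I$ is the identity. $\mathfrak{sl}_2$ has relations $[J_0,J_\pm]=\pm J_\pm$, $[J_+,J_-]=2J_0$, and $C$ is central in $\mathcal U(\mathfrak{sl}_2)$. Since the quadratic equation for $\xi_1$ involves $C$, $\xi_1$ is to be understood as a central element commuting with $J_0,J_\pm$ and satisfying that equation, i.e. one works over $\mathbb C$ in the extension $\mathcal U(\mathfrak{sl}_2)\otimes_{\mathbb C[C]}\mathbb C[C][\xi_1]/(\text{quadratic equation})$ (the paper speaks of a "completion" of $\mathcal U(\mathfrak{sl}_2)$); in an irreducible representation $C$ and $\xi_1$ are numbers. "Embedding" is used in the sense that the displayed elements satisfy the defining relations. *)

theory Defs
  imports Complex_Main "HOL-Library.Poly_Mapping" "HOL-Algebra.UnivPoly" "HOL-Algebra.QuotRing"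
begin

datatype sl2_gen = Gen0 | GenPlus | GenMinus

(* The free monoid on the generators, written additively (concatenation is +, the empty word is 0),
   because Poly_Mapping multiplies along a monoid_add of keys. *)
datatype sl2_word = Sl2_Word "sl2_gen list"

instantiation sl2_word :: monoid_add
begin

definition zero_sl2_word :: sl2_word
  where "zero_sl2_word = Sl2_Word []"

fun plus_sl2_word :: "sl2_word \<Rightarrow> sl2_word \<Rightarrow> sl2_word"
  where "plus_sl2_word (Sl2_Word u) (Sl2_Word v) = Sl2_Word (u @ v)"

instance
proof
  fix a b c :: sl2_word
  show "a + b + c = a + (b + c)" by (cases a; cases b; cases c) simp
  show "0 + a = a" by (cases a) (simp add: zero_sl2_word_def)
  show "a + 0 = a" by (cases a) (simp add: zero_sl2_word_def)
qed

end

(* The monoid algebra of the free monoid, i.e. the free unital associative complex algebra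
   on the three generators; its product is noncommutative convolution. *)
type_synonym sl2_free = "sl2_word \<Rightarrow>\<^sub>0 complex"

definition free_alg :: "sl2_free ring"
  where "free_alg = \<lparr>carrier = UNIV, monoid.mult = (*), one = 1, zero = 0, add = (+)\<rparr>"

definition free_gen :: "sl2_gen \<Rightarrow> sl2_free"
  where "free_gen g = Poly_Mapping.single (Sl2_Word [g]) 1"

definition free_scalar :: "complex \<Rightarrow> sl2_free"
  where "free_scalar c = Poly_Mapping.single 0 c"

definition commutator :: "('a, 'm) ring_scheme \<Rightarrow> 'a \<Rightarrow> 'a \<Rightarrow> 'a"
  where "commutator R a b = a \<otimes>\<^bsub>R\<^esub> b \<ominus>\<^bsub>R\<^esub> b \<otimes>\<^bsub>R\<^esub> a"

definition anticommutator :: "('a, 'm) ring_scheme \<Rightarrow> 'a \<Rightarrow> 'a \<Rightarrow> 'a"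
  where "anticommutator R a b = a \<otimes>\<^bsub>R\<^esub> b \<oplus>\<^bsub>R\<^esub> b \<otimes>\<^bsub>R\<^esub> a"

(* Two-sided: HOL-Algebra's notion of ideal is two-sided in a noncommutative ring. *)
definition sl2_ideal :: "sl2_free set"
  where "sl2_ideal = Idl\<^bsub>free_alg\<^esub>
    {commutator free_alg (free_gen Gen0) (free_gen GenPlus) - free_gen GenPlus,
     commutator free_alg (free_gen Gen0) (free_gen GenMinus) + free_gen GenMinus,
     commutator free_alg (free_gen GenPlus) (free_gen GenMinus)
       - free_scalar 2 * free_gen Gen0}"

definition U_sl2 :: "sl2_free set ring"
  where "U_sl2 = free_alg Quot sl2_ideal"

definition U_gen :: "sl2_gen \<Rightarrow> sl2_free set"
  where "U_gen g = sl2_ideal +>\<^bsub>free_alg\<^esub> free_gen g"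

definition U_scalar :: "complex \<Rightarrow> sl2_free set"
  where "U_scalar c = sl2_ideal +>\<^bsub>free_alg\<^esub> free_scalar c"

definition casimir :: "('a, 'm) ring_scheme \<Rightarrow> 'a \<Rightarrow> 'a \<Rightarrow> 'a \<Rightarrow> 'a"
  where "casimir R j0 jp jm = j0 \<otimes>\<^bsub>R\<^esub> j0 \<ominus>\<^bsub>R\<^esub> j0 \<oplus>\<^bsub>R\<^esub> jp \<otimes>\<^bsub>R\<^esub> jm"

definition U_casimir :: "sl2_free set"
  where "U_casimir = casimir U_sl2 (U_gen Gen0) (U_gen GenPlus) (U_gen GenMinus)"

type_synonym U_poly = "nat \<Rightarrow> sl2_free set"

(* The quadratic equation for xi_1 as a polynomial over U(sl_2) in a central indeterminate;
   the parameters eta_0, ..., eta_4 are the first five values of eta. *)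
definition xi1_poly :: "(nat \<Rightarrow> complex) \<Rightarrow> U_poly"
  where "xi1_poly \<eta> =
    monom (UP U_sl2) (U_scalar (- (\<eta> 4)\<^sup>2)) 2
    \<oplus>\<^bsub>UP U_sl2\<^esub> monom (UP U_sl2) (U_scalar (\<eta> 4 * (\<eta> 4 - 2 * \<eta> 1))) 1
    \<oplus>\<^bsub>UP U_sl2\<^esub> monom (UP U_sl2)
      (U_scalar (- 2 * (\<eta> 1)\<^sup>2 + 2 * \<eta> 1 * \<eta> 3 - 2 * \<eta> 0 * \<eta> 4 + \<eta> 4 * \<eta> 1 + \<eta> 2 * \<eta> 4)
       \<oplus>\<^bsub>U_sl2\<^esub> U_scalar ((\<eta> 4)\<^sup>2) \<otimes>\<^bsub>U_sl2\<^esub> U_casimir) 0"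

definition ext_ideal :: "(nat \<Rightarrow> complex) \<Rightarrow> U_poly set"
  where "ext_ideal \<eta> = Idl\<^bsub>UP U_sl2\<^esub> {xi1_poly \<eta>}"

(* With q the quadratic polynomial, U[t]/(q) is the tensor product of U with C[C][t]/(q)
   over C[C], since q has coefficients in the central subalgebra C[C]. *)
definition U_ext :: "(nat \<Rightarrow> complex) \<Rightarrow> U_poly set ring"
  where "U_ext \<eta> = UP U_sl2 Quot ext_ideal \<eta>"

definition ext_of_U :: "(nat \<Rightarrow> complex) \<Rightarrow> sl2_free set \<Rightarrow> U_poly set"
  where "ext_of_U \<eta> u = ext_ideal \<eta> +>\<^bsub>UP U_sl2\<^esub> monom (UP U_sl2) u 0"

definition ext_gen :: "(nat \<Rightarrow> complex) \<Rightarrow> sl2_gen \<Rightarrow> U_poly set"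
  where "ext_gen \<eta> g = ext_of_U \<eta> (U_gen g)"

definition ext_scalar :: "(nat \<Rightarrow> complex) \<Rightarrow> complex \<Rightarrow> U_poly set"
  where "ext_scalar \<eta> c = ext_of_U \<eta> (U_scalar c)"

(* The class of the indeterminate. By ext_root_commutes and ext_root_equation below it is a root
   of the quadratic equation commuting with U(sl_2), so such roots exist in the extension. *)
definition ext_root :: "(nat \<Rightarrow> complex) \<Rightarrow> U_poly set"
  where "ext_root \<eta> = ext_ideal \<eta> +>\<^bsub>UP U_sl2\<^esub> monom (UP U_sl2) \<one>\<^bsub>U_sl2\<^esub> 1"

lemma free_alg_ring: "ring free_alg"
proof (rule ringI)
  show "abelian_group free_alg"
  proof (rule abelian_groupI)
    fix x assume "x \<in> carrier free_alg"
    show "\<exists>y\<in>carrier free_alg. y \<oplus>\<^bsub>free_alg\<^esub> x = \<zero>\<^bsub>free_alg\<^esub>"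
      by (rule bexI[of _ "- x"]) (simp_all add: free_alg_def)
  qed (simp_all add: free_alg_def add_ac)
  show "Group.monoid free_alg"
    by (rule monoidI) (simp_all add: free_alg_def mult.assoc)
qed (simp_all add: free_alg_def distrib_left distrib_right)

lemma sl2_ideal_ideal: "ideal sl2_ideal free_alg"
  unfolding sl2_ideal_def
  by (rule ring.genideal_ideal[OF free_alg_ring]) (simp add: free_alg_def)

lemma U_sl2_ring: "ring U_sl2"
  unfolding U_sl2_def by (rule ideal.quotient_is_ring[OF sl2_ideal_ideal])

lemma U_class_closed: "sl2_ideal +>\<^bsub>free_alg\<^esub> p \<in> carrier U_sl2"
  using ring_hom_closed[OF ideal.rcos_ring_hom[OF sl2_ideal_ideal], of p]
  by (simp add: free_alg_def U_sl2_def)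

lemma U_gen_closed: "U_gen g \<in> carrier U_sl2"
  and U_scalar_closed: "U_scalar c \<in> carrier U_sl2"
  by (simp_all add: U_gen_def U_scalar_def U_class_closed)

lemma U_casimir_closed: "U_casimir \<in> carrier U_sl2"
proof -
  interpret U: ring U_sl2 by (rule U_sl2_ring)
  show ?thesis by (simp add: U_casimir_def casimir_def U_gen_closed)
qed

lemma UP_ring_U: "UP_ring U_sl2"
  using U_sl2_ring by (simp add: UP_ring_def)

lemma xi1_poly_closed: "xi1_poly \<eta> \<in> carrier (UP U_sl2)"
proof -
  interpret P: UP_ring U_sl2 "UP U_sl2" by (rule UP_ring_U) simp
  show ?thesis
    by (simp add: xi1_poly_def U_scalar_closed U_casimir_closed)
qed

lemma ext_ideal_ideal: "ideal (ext_ideal \<eta>) (UP U_sl2)"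
  unfolding ext_ideal_def
  by (rule ring.genideal_ideal[OF UP_ring.UP_ring[OF UP_ring_U]]) (simp add: xi1_poly_closed)

lemma U_ext_ring: "ring (U_ext \<eta>)"
  unfolding U_ext_def by (rule ideal.quotient_is_ring[OF ext_ideal_ideal])

lemma ext_proj_hom: "(\<lambda>p. ext_ideal \<eta> +>\<^bsub>UP U_sl2\<^esub> p) \<in> ring_hom (UP U_sl2) (U_ext \<eta>)"
  unfolding U_ext_def by (rule ideal.rcos_ring_hom[OF ext_ideal_ideal])

lemma ext_of_U_hom: "ext_of_U \<eta> \<in> ring_hom U_sl2 (U_ext \<eta>)"
proof -
  interpret P: UP_ring U_sl2 "UP U_sl2" by (rule UP_ring_U) simp
  have "ext_of_U \<eta> = (\<lambda>p. ext_ideal \<eta> +>\<^bsub>UP U_sl2\<^esub> p) \<circ> (\<lambda>u. monom (UP U_sl2) u 0)"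
    by (simp add: fun_eq_iff ext_of_U_def)
  then show ?thesis
    using ring_hom_trans[OF P.const_ring_hom ext_proj_hom] by simp
qed

lemma ext_root_closed: "ext_root \<eta> \<in> carrier (U_ext \<eta>)"
proof -
  interpret P: UP_ring U_sl2 "UP U_sl2" by (rule UP_ring_U) simp
  show ?thesis
    unfolding ext_root_def by (rule ring_hom_closed[OF ext_proj_hom]) simp
qed

lemma ext_root_commutes:
  assumes u: "u \<in> carrier U_sl2"
  shows "ext_root \<eta> \<otimes>\<^bsub>U_ext \<eta>\<^esub> ext_of_U \<eta> u = ext_of_U \<eta> u \<otimes>\<^bsub>U_ext \<eta>\<^esub> ext_root \<eta>"
proof -
  interpret P: UP_ring U_sl2 "UP U_sl2" by (rule UP_ring_U) simp
  have "monom (UP U_sl2) \<one>\<^bsub>U_sl2\<^esub> 1 \<otimes>\<^bsub>UP U_sl2\<^esub> monom (UP U_sl2) u 0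
      = monom (UP U_sl2) u 0 \<otimes>\<^bsub>UP U_sl2\<^esub> monom (UP U_sl2) \<one>\<^bsub>U_sl2\<^esub> 1"
    using u P.monom_mult[of "\<one>\<^bsub>U_sl2\<^esub>" u 1 0] P.monom_mult[of u "\<one>\<^bsub>U_sl2\<^esub>" 0 1]
    by (simp del: P.monom_mult)
  then show ?thesis
    unfolding ext_root_def ext_of_U_def
    using u by (simp add: ring_hom_mult[OF ext_proj_hom, symmetric])
qed

lemma ext_casimir:
  "casimir (U_ext \<eta>) (ext_gen \<eta> Gen0) (ext_gen \<eta> GenPlus) (ext_gen \<eta> GenMinus)
    = ext_of_U \<eta> U_casimir"
proof -
  interpret h: ring_hom_ring U_sl2 "U_ext \<eta>" "ext_of_U \<eta>"
    by (rule ring_hom_ringI2[OF U_sl2_ring U_ext_ring ext_of_U_hom])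
  show ?thesis
    by (simp add: casimir_def U_casimir_def ext_gen_def U_gen_closed a_minus_def)
qed

lemma ext_root_equation:
  "ext_scalar \<eta> (- (\<eta> 4)\<^sup>2) \<otimes>\<^bsub>U_ext \<eta>\<^esub> (ext_root \<eta> [^]\<^bsub>U_ext \<eta>\<^esub> (2::nat))
    \<oplus>\<^bsub>U_ext \<eta>\<^esub> ext_scalar \<eta> (\<eta> 4 * (\<eta> 4 - 2 * \<eta> 1)) \<otimes>\<^bsub>U_ext \<eta>\<^esub> ext_root \<eta>
    \<oplus>\<^bsub>U_ext \<eta>\<^esub> ext_scalar \<eta>
      (- 2 * (\<eta> 1)\<^sup>2 + 2 * \<eta> 1 * \<eta> 3 - 2 * \<eta> 0 * \<eta> 4 + \<eta> 4 * \<eta> 1 + \<eta> 2 * \<eta> 4)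
    \<oplus>\<^bsub>U_ext \<eta>\<^esub> ext_scalar \<eta> ((\<eta> 4)\<^sup>2) \<otimes>\<^bsub>U_ext \<eta>\<^esub>
      casimir (U_ext \<eta>) (ext_gen \<eta> Gen0) (ext_gen \<eta> GenPlus) (ext_gen \<eta> GenMinus)
    = \<zero>\<^bsub>U_ext \<eta>\<^esub>"
proof -
  interpret P: UP_ring U_sl2 "UP U_sl2" by (rule UP_ring_U) simp
  interpret E: ring "U_ext \<eta>" by (rule U_ext_ring)
  let ?P = "UP U_sl2" and ?E = "U_ext \<eta>"
  define \<pi> where "\<pi> = (\<lambda>p. ext_ideal \<eta> +>\<^bsub>?P\<^esub> p)"
  interpret p: ring_hom_ring ?P ?E \<pi>
    unfolding \<pi>_def by (rule ring_hom_ringI2[OF P.UP_ring U_ext_ring ext_proj_hom])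
  interpret h: ring_hom_ring U_sl2 ?E "ext_of_U \<eta>"
    by (rule ring_hom_ringI2[OF U_sl2_ring U_ext_ring ext_of_U_hom])
  have c: "\<pi> (monom ?P u 0) = ext_of_U \<eta> u" for u
    by (simp add: \<pi>_def ext_of_U_def)
  have t: "\<pi> (monom ?P \<one>\<^bsub>U_sl2\<^esub> 1) = ext_root \<eta>"
    by (simp add: \<pi>_def ext_root_def)
  have m1: "\<pi> (monom ?P u 1) = ext_of_U \<eta> u \<otimes>\<^bsub>?E\<^esub> ext_root \<eta>" if u: "u \<in> carrier U_sl2" for u
  proof -
    have "monom ?P u 1 = monom ?P u 0 \<otimes>\<^bsub>?P\<^esub> monom ?P \<one>\<^bsub>U_sl2\<^esub> 1"
      using u P.monom_mult[of u "\<one>\<^bsub>U_sl2\<^esub>" 0 1] by (simp del: P.monom_mult)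
    then show ?thesis
      using u by (simp only: p.hom_mult P.monom_closed P.R.one_closed c t)
  qed
  have m2: "\<pi> (monom ?P u 2) = ext_of_U \<eta> u \<otimes>\<^bsub>?E\<^esub> (ext_root \<eta> [^]\<^bsub>?E\<^esub> (2::nat))"
    if u: "u \<in> carrier U_sl2" for u
  proof -
    have "monom ?P u 2 = monom ?P u 1 \<otimes>\<^bsub>?P\<^esub> monom ?P \<one>\<^bsub>U_sl2\<^esub> 1"
      using u P.monom_mult[of u "\<one>\<^bsub>U_sl2\<^esub>" 1 1] by (simp del: P.monom_mult add: numeral_2_eq_2)
    then have "\<pi> (monom ?P u 2) = ext_of_U \<eta> u \<otimes>\<^bsub>?E\<^esub> ext_root \<eta> \<otimes>\<^bsub>?E\<^esub> ext_root \<eta>"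
      using u by (simp only: p.hom_mult P.monom_closed P.R.one_closed m1 t)
    then show ?thesis
      using u by (simp add: numeral_2_eq_2 E.m_assoc ext_root_closed h.hom_closed)
  qed
  have "xi1_poly \<eta> \<in> ext_ideal \<eta>"
    unfolding ext_ideal_def using P.genideal_self'[OF xi1_poly_closed] .
  then have "\<pi> (xi1_poly \<eta>) = \<zero>\<^bsub>?E\<^esub>"
    using ideal.Icarr[OF ext_ideal_ideal] P.a_coset_join2[of "xi1_poly \<eta>" "ext_ideal \<eta>"]
      ideal.axioms(1)[OF ext_ideal_ideal, THEN additive_subgroup.a_subgroup]
    by (simp add: \<pi>_def U_ext_def FactRing_def xi1_poly_closed)
  moreover have "\<pi> (xi1_poly \<eta>) =
      ext_of_U \<eta> (U_scalar (- (\<eta> 4)\<^sup>2)) \<otimes>\<^bsub>?E\<^esub> (ext_root \<eta> [^]\<^bsub>?E\<^esub> (2::nat))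
      \<oplus>\<^bsub>?E\<^esub> ext_of_U \<eta> (U_scalar (\<eta> 4 * (\<eta> 4 - 2 * \<eta> 1))) \<otimes>\<^bsub>?E\<^esub> ext_root \<eta>
      \<oplus>\<^bsub>?E\<^esub> (ext_of_U \<eta> (U_scalar
          (- 2 * (\<eta> 1)\<^sup>2 + 2 * \<eta> 1 * \<eta> 3 - 2 * \<eta> 0 * \<eta> 4 + \<eta> 4 * \<eta> 1 + \<eta> 2 * \<eta> 4))
        \<oplus>\<^bsub>?E\<^esub> ext_of_U \<eta> (U_scalar ((\<eta> 4)\<^sup>2)) \<otimes>\<^bsub>?E\<^esub> ext_of_U \<eta> U_casimir)"
    unfolding xi1_poly_def
    by (simp only: p.hom_add h.hom_add h.hom_mult P.a_closed P.monom_closed P.R.a_closed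
        P.R.m_closed U_scalar_closed U_casimir_closed m1 m2 c)
  ultimately show ?thesis
    by (simp add: ext_casimir ext_scalar_def E.a_assoc U_scalar_closed U_casimir_closed
        ext_root_closed h.hom_closed)
qed

end

theory Submission
  imports "HOL-Computational_Algebra.Polynomial" "HOL-Algebra.Multiplicative_Group" Defs
begin

text \<open>Everything takes place over the commutative ring of complex polynomials in \<open>\<xi>\<^sub>1\<close>. Since
  \<open>\<eta> 4\<close> is invertible, the quadratic equation expresses the Casimir element as such a polynomial
  \<open>k\<close>, so that \<open>J\<^sub>+ J\<^sub>- = k - J\<^sub>0\<^sup>2 + J\<^sub>0\<close> and \<open>J\<^sub>- J\<^sub>+ = k - J\<^sub>0\<^sup>2 - J\<^sub>0\<close>. Both sides of
  the last two relations then become linear combinations of \<open>J\<^sub>0\<^sup>2 J\<^sub>+\<close>, \<open>J\<^sub>0 J\<^sub>+\<close>, \<open>J\<^sub>+\<close>, \<open>J\<^sub>0\<^sup>2\<close>, \<open>J\<^sub>0\<close>,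
  \<open>J\<^sub>-\<close> and \<open>1\<close> whose coefficients agree.\<close>

section \<open>Scalars in a noncommutative ring\<close>

text \<open>The scalar ring is left abstract because two instances occur: the complex numbers, and
  the complex polynomials acting through evaluation at \<open>\<xi>\<^sub>1\<close>.\<close>

locale scalar_hom = ring R for R (structure) +
  fixes \<phi> :: "'k::comm_ring_1 \<Rightarrow> 'a"
  assumes scalar_closed [simp, intro]: "\<phi> c \<in> carrier R"
    and scalar_add: "\<phi> (c + d) = \<phi> c \<oplus> \<phi> d"
    and scalar_mult: "\<phi> (c * d) = \<phi> c \<otimes> \<phi> d"
    and scalar_one: "\<phi> 1 = \<one>"
begin

lemma scalar_zero: "\<phi> 0 = \<zero>"
  using scalar_add[of 0 0] by simp

lemma scalar_minus: "\<phi> (- c) = \<ominus> \<phi> c"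
  by (rule minus_equality[symmetric]) (simp_all flip: scalar_add add: scalar_zero)

lemma scalar_diff: "\<phi> (c - d) = \<phi> c \<ominus> \<phi> d"
  by (simp add: diff_conv_add_uminus scalar_add scalar_minus minus_eq del: add_uminus_conv_diff)

end

text \<open>Horner's scheme, with the coefficients carried into the ring by
  \<open>\<phi>\<close>.\<close>

definition (in scalar_hom) eval_poly :: "'a \<Rightarrow> 'k poly \<Rightarrow> 'a"
  where "eval_poly x f = fold_coeffs (\<lambda>c r. \<phi> c \<oplus> x \<otimes> r) f \<zero>"

locale scalar_hom_eval = scalar_hom +
  fixes x
  assumes x_closed [simp, intro]: "x \<in> carrier R"
    and x_commutes: "x \<otimes> \<phi> c = \<phi> c \<otimes> x"
begin

lemma eval_poly_0 [simp]: "eval_poly x 0 = \<zero>"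
  by (simp add: eval_poly_def)

lemma eval_poly_pCons [simp]: "eval_poly x (pCons c f) = \<phi> c \<oplus> x \<otimes> eval_poly x f"
  \<comment> \<open>For \<open>pCons 0 0\<close> the fold takes no step; both sides are then zero
    because \<open>\<phi> 0\<close> is.\<close>
  by (cases "c = 0 \<and> f = 0") (auto simp: eval_poly_def scalar_zero)

lemma eval_poly_closed [simp, intro]: "eval_poly x f \<in> carrier R"
  by (induction f) auto

lemma eval_poly_add: "eval_poly x (f + g) = eval_poly x f \<oplus> eval_poly x g"
proof (induction f g rule: poly_induct2)
  case (pCons a p b q)
  then show ?case by (simp add: scalar_add r_distr a_ac)
qed simp

lemma eval_poly_smult: "eval_poly x (Polynomial.smult c f) = \<phi> c \<otimes> eval_poly x f"
  by (induction f) (simp_all add: scalar_mult r_distr x_commutes flip: m_assoc)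

lemma eval_poly_mult: "eval_poly x (f * g) = eval_poly x f \<otimes> eval_poly x g"
  by (induction f)
    (simp_all add: eval_poly_add eval_poly_smult scalar_zero l_distr m_assoc)

text \<open>Since \<open>x\<close> commutes with the coefficients, evaluation is multiplicative even
  in a noncommutative ring. Polynomials in \<open>x\<close> can therefore serve as scalars
  themselves.\<close>

lemma scalar_hom_eval_poly: "scalar_hom R (eval_poly x)"
proof
  show "eval_poly x 1 = \<one>"
    by (simp add: one_pCons scalar_one del: pCons_one)
qed (simp_all add: eval_poly_add eval_poly_mult)

text \<open>Horner's scheme involves only \<open>x\<close> and values of \<open>\<phi>\<close>, so
  commuting with these is enough. This is how polynomials in \<open>\<xi>\<^sub>1\<close> come to
  commute with the generators.\<close>

lemma eval_poly_commutes:
  assumes "y \<in> carrier R" and "x \<otimes> y = y \<otimes> x" and "\<And>c. \<phi> c \<otimes> y = y \<otimes> \<phi> c"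
  shows "eval_poly x f \<otimes> y = y \<otimes> eval_poly x f"
proof (induction f)
  case (pCons c f)
  have "x \<otimes> eval_poly x f \<otimes> y = x \<otimes> y \<otimes> eval_poly x f"
    using assms(1) pCons.IH by (simp add: m_assoc)
  also have "\<dots> = y \<otimes> (x \<otimes> eval_poly x f)"
    using assms(1,2) by (simp add: m_assoc)
  finally show ?case
    using assms by (simp add: l_distr r_distr)
qed (use assms in simp)

end

section \<open>Commutators of \<open>sl\<^sub>2\<close> generators\<close>

context ring
begin

lemma commutator_closed [simp, intro]:
  "\<lbrakk>a \<in> carrier R; b \<in> carrier R\<rbrakk> \<Longrightarrow> commutator R a b \<in> carrier R"
  by (simp add: commutator_def)

lemma commutator_add_left:
  "\<lbrakk>a \<in> carrier R; b \<in> carrier R; c \<in> carrier R\<rbrakk>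
    \<Longrightarrow> commutator R (a \<oplus> b) c = commutator R a c \<oplus> commutator R b c"
  by (simp add: commutator_def minus_eq l_distr r_distr minus_add a_ac)

lemma commutator_add_right:
  "\<lbrakk>a \<in> carrier R; b \<in> carrier R; c \<in> carrier R\<rbrakk>
    \<Longrightarrow> commutator R c (a \<oplus> b) = commutator R c a \<oplus> commutator R c b"
  by (simp add: commutator_def minus_eq l_distr r_distr minus_add a_ac)

lemma commutator_swap:
  "\<lbrakk>a \<in> carrier R; b \<in> carrier R\<rbrakk> \<Longrightarrow> commutator R a b = \<ominus> commutator R b a"
  by (simp add: commutator_def minus_eq minus_add a_ac)

lemma commutator_self: "a \<in> carrier R \<Longrightarrow> commutator R a a = \<zero>"
  by (simp add: commutator_def r_neg minus_eq)

text \<open>Leibniz rule: bracketing with a fixed element is a derivation. It reduces brackets of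
  words to brackets of generators.\<close>

lemma commutator_mult_left:
  "\<lbrakk>a \<in> carrier R; b \<in> carrier R; c \<in> carrier R\<rbrakk>
    \<Longrightarrow> commutator R (a \<otimes> b) c = a \<otimes> commutator R b c \<oplus> commutator R a c \<otimes> b"
  by (simp add: commutator_def minus_eq l_distr r_distr l_minus r_minus m_assoc a_assoc r_neg1 r_neg2 l_neg)

lemma commutator_mult_right:
  "\<lbrakk>a \<in> carrier R; b \<in> carrier R; c \<in> carrier R\<rbrakk>
    \<Longrightarrow> commutator R c (a \<otimes> b) = a \<otimes> commutator R c b \<oplus> commutator R c a \<otimes> b"
  using commutator_mult_left[of a b c]
  by (simp add: commutator_swap[of c] l_minus r_minus minus_add)

lemma commutator_eq_zero_iff:
  "\<lbrakk>a \<in> carrier R; b \<in> carrier R\<rbrakk> \<Longrightarrow> commutator R a b = \<zero> \<longleftrightarrow> a \<otimes> b = b \<otimes> a"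
  by (simp add: commutator_def)

end

text \<open>Scalars are required to commute with the generators, which is what is known of
  polynomials in \<open>\<xi>\<^sub>1\<close>. The Casimir element is a scalar, as in an irreducible
  representation, but \<open>k\<close> lies in the scalar ring and so may involve
  \<open>\<xi>\<^sub>1\<close>.\<close>

locale sl2_triple = scalar_hom +
  fixes a p m k
  assumes a_carrier [simp, intro]: "a \<in> carrier R"
    and p_carrier [simp, intro]: "p \<in> carrier R"
    and m_carrier [simp, intro]: "m \<in> carrier R"
    and a_scalar: "a \<otimes> \<phi> c = \<phi> c \<otimes> a"
    and p_scalar: "p \<otimes> \<phi> c = \<phi> c \<otimes> p"
    and m_scalar: "m \<otimes> \<phi> c = \<phi> c \<otimes> m"
    and commutator_a_p: "commutator R a p = p"
    and commutator_a_m: "commutator R a m = \<ominus> m"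
    and commutator_p_m: "commutator R p m = \<phi> 2 \<otimes> a"
    and casimir_eq: "casimir R a p m = \<phi> k"
begin

text \<open>A common shape for the two sides of an identity: equal coefficients give equal elements,
  so an identity reduces to seven equations in the commutative scalar ring.\<close>

definition lin_comb :: "'c \<Rightarrow> 'c \<Rightarrow> 'c \<Rightarrow> 'c \<Rightarrow> 'c \<Rightarrow> 'c \<Rightarrow> 'c \<Rightarrow> 'a"
  where "lin_comb c1 c2 c3 c4 c5 c6 c7 =
    \<phi> c1 \<otimes> (a \<otimes> (a \<otimes> p)) \<oplus> \<phi> c2 \<otimes> (a \<otimes> p) \<oplus> \<phi> c3 \<otimes> p
    \<oplus> \<phi> c4 \<otimes> (a \<otimes> a) \<oplus> \<phi> c5 \<otimes> a \<oplus> \<phi> c6 \<otimes> m \<oplus> \<phi> c7"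

lemma lin_comb_closed [simp, intro]: "lin_comb c1 c2 c3 c4 c5 c6 c7 \<in> carrier R"
  by (simp add: lin_comb_def)

lemma lin_comb_add:
  "lin_comb c1 c2 c3 c4 c5 c6 c7 \<oplus> lin_comb d1 d2 d3 d4 d5 d6 d7 =
    lin_comb (c1 + d1) (c2 + d2) (c3 + d3) (c4 + d4) (c5 + d5) (c6 + d6) (c7 + d7)"
  by (simp add: lin_comb_def scalar_add l_distr a_ac)

lemma lin_comb_scalar:
  "\<phi> c \<otimes> lin_comb c1 c2 c3 c4 c5 c6 c7 =
    lin_comb (c * c1) (c * c2) (c * c3) (c * c4) (c * c5) (c * c6) (c * c7)"
  by (simp add: lin_comb_def scalar_mult r_distr m_assoc)

lemma lin_comb_add_scalar:
  "lin_comb c1 c2 c3 c4 c5 c6 c7 \<oplus> \<phi> d = lin_comb c1 c2 c3 c4 c5 c6 (c7 + d)"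
  by (simp add: lin_comb_def scalar_add a_assoc)

lemma uminus_eq_scalar: "x \<in> carrier R \<Longrightarrow> \<ominus> x = \<phi> (- 1) \<otimes> x"
  by (simp add: scalar_minus scalar_one l_minus)

lemma lin_comb_uminus:
  "\<ominus> lin_comb c1 c2 c3 c4 c5 c6 c7 =
    lin_comb (- c1) (- c2) (- c3) (- c4) (- c5) (- c6) (- c7)"
  by (simp add: uminus_eq_scalar lin_comb_scalar)

lemma lin_comb_a: "a = lin_comb 0 0 0 0 1 0 0"
  by (simp add: lin_comb_def scalar_zero scalar_one)

lemma a_scalar_left_commute: "x \<in> carrier R \<Longrightarrow> a \<otimes> (\<phi> c \<otimes> x) = \<phi> c \<otimes> (a \<otimes> x)"
  by (simp add: a_scalar flip: m_assoc)

lemma p_mult_a: "p \<otimes> a = a \<otimes> p \<ominus> p"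
proof -
  have "a \<otimes> p \<ominus> p = a \<otimes> p \<ominus> (a \<otimes> p \<ominus> p \<otimes> a)"
    using commutator_a_p by (simp add: commutator_def)
  then show ?thesis
    by (simp add: minus_eq minus_add r_neg2)
qed

lemma p_mult_m: "p \<otimes> m = lin_comb 0 0 0 (- 1) 1 0 k"
proof -
  have "p \<otimes> m = a \<oplus> (\<ominus> (a \<otimes> a) \<oplus> casimir R a p m)"
    by (simp add: casimir_def minus_eq a_assoc r_neg1 r_neg2)
  then show ?thesis
    by (simp add: casimir_eq lin_comb_def scalar_zero scalar_one scalar_minus minus_eq l_minus a_ac)
qed

lemma m_mult_p: "m \<otimes> p = lin_comb 0 0 0 (- 1) (- 1) 0 k"
proof -
  have "m \<otimes> p = p \<otimes> m \<ominus> commutator R p m"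
    by (simp add: commutator_def minus_eq minus_add r_neg2)
  also have "\<dots> = p \<otimes> m \<oplus> \<phi> (- 2) \<otimes> lin_comb 0 0 0 0 1 0 0"
    by (simp add: commutator_p_m minus_eq scalar_minus l_minus flip: lin_comb_a)
  finally show ?thesis
    by (simp add: p_mult_m lin_comb_scalar lin_comb_add)
qed

text \<open>The zero arguments leave out words such as \<open>a \<otimes> a\<close> in the first
  rule or \<open>p\<close> in the third, whose products \<open>a \<otimes> a \<otimes> a\<close> and
  \<open>p \<otimes> p\<close> are not among the seven words. In the third rule
  \<open>m \<otimes> p\<close> is replaced by its Casimir expression.\<close>

lemma lin_comb_mult:
  "a \<otimes> lin_comb 0 c2 c3 0 c5 0 c7 = lin_comb c2 c3 0 c5 c7 0 0"
  "lin_comb 0 0 c3 0 c5 0 c7 \<otimes> a = lin_comb 0 c3 (- c3) c5 c7 0 0"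
  "lin_comb 0 0 0 c4 c5 c6 c7 \<otimes> p = lin_comb c4 c5 c7 (- c6) (- c6) 0 (k * c6)"
proof -
  show "a \<otimes> lin_comb 0 c2 c3 0 c5 0 c7 = lin_comb c2 c3 0 c5 c7 0 0"
    by (simp add: lin_comb_def scalar_zero r_distr a_scalar_left_commute a_scalar)
  show "lin_comb 0 0 c3 0 c5 0 c7 \<otimes> a = lin_comb 0 c3 (- c3) c5 c7 0 0"
    by (simp add: lin_comb_def scalar_zero l_distr m_assoc p_mult_a minus_eq r_distr r_minus
        scalar_minus l_minus)
  have "lin_comb 0 0 0 c4 c5 c6 c7 \<otimes> p = lin_comb c4 c5 c7 0 0 0 0 \<oplus> \<phi> c6 \<otimes> (m \<otimes> p)"
    by (simp add: lin_comb_def scalar_zero l_distr m_assoc a_ac)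
  then show "lin_comb 0 0 0 c4 c5 c6 c7 \<otimes> p = lin_comb c4 c5 c7 (- c6) (- c6) 0 (k * c6)"
    by (simp add: m_mult_p lin_comb_scalar lin_comb_add mult.commute)
qed

lemma lin_comb_zero: "\<zero> = lin_comb 0 0 0 0 0 0 0"
  by (simp add: lin_comb_def scalar_zero)

lemma commutators_generators:
  "commutator R a p = lin_comb 0 0 1 0 0 0 0"
  "commutator R p a = lin_comb 0 0 (- 1) 0 0 0 0"
  "commutator R a m = lin_comb 0 0 0 0 0 (- 1) 0"
  "commutator R p m = lin_comb 0 0 0 0 2 0 0"
  "commutator R a a = lin_comb 0 0 0 0 0 0 0"
  using commutator_a_p commutator_a_m commutator_p_m commutator_swap[of p a]
  by (simp_all add: commutator_self lin_comb_def scalar_zero scalar_one scalar_minus l_minus)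

text \<open>All follow from the Leibniz rule. The Casimir value enters through [ap,m] = 2aa - mp =
  3aa + a - k. The bracket of \<open>p\<close> with \<open>a \<otimes> p\<close> stays outside the
  normal form, as \<open>p \<otimes> p\<close> is not one of its words.\<close>

lemma commutators_words:
  "commutator R p (a \<otimes> a) = lin_comb 0 (- 2) 1 0 0 0 0"
  "commutator R a (a \<otimes> a) = lin_comb 0 0 0 0 0 0 0"
  "commutator R p (a \<otimes> p) = \<ominus> (p \<otimes> p)"
  "commutator R (a \<otimes> p) a = lin_comb 0 (- 1) 0 0 0 0 0"
  "commutator R (a \<otimes> p) (a \<otimes> a) = lin_comb (- 2) 1 0 0 0 0 0"
  "commutator R (a \<otimes> p) m = lin_comb 0 0 0 3 1 0 (- k)"
proof -
  show *: "commutator R p (a \<otimes> a) = lin_comb 0 (- 2) 1 0 0 0 0"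
    "commutator R a (a \<otimes> a) = lin_comb 0 0 0 0 0 0 0"
    by (simp_all add: commutator_mult_right commutators_generators lin_comb_mult lin_comb_add)
  show "commutator R p (a \<otimes> p) = \<ominus> (p \<otimes> p)"
    using commutator_swap[of p a]
    by (simp add: commutator_mult_right commutator_self commutator_a_p l_minus)
  show "commutator R (a \<otimes> p) a = lin_comb 0 (- 1) 0 0 0 0 0"
    "commutator R (a \<otimes> p) (a \<otimes> a) = lin_comb (- 2) 1 0 0 0 0 0"
    "commutator R (a \<otimes> p) m = lin_comb 0 0 0 3 1 0 (- k)"
    by (simp_all add: commutator_mult_left * commutators_generators lin_comb_mult lin_comb_add)
qed

lemma commutator_scalar_generators:
  "commutator R (\<phi> c) a = \<zero>" "commutator R (\<phi> c) p = \<zero>" "commutator R (\<phi> c) m = \<zero>"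
  "commutator R (\<phi> c) (\<phi> d) = \<zero>"
  by (simp_all add: commutator_eq_zero_iff a_scalar p_scalar m_scalar mult.commute
      flip: scalar_mult)

lemma commutator_scalar:
  "commutator R (\<phi> c) (a \<otimes> a) = \<zero>" "commutator R (\<phi> c) (a \<otimes> p) = \<zero>"
  "commutator R a (\<phi> c) = \<zero>" "commutator R p (\<phi> c) = \<zero>" "commutator R m (\<phi> c) = \<zero>"
  "commutator R (a \<otimes> a) (\<phi> c) = \<zero>" "commutator R (a \<otimes> p) (\<phi> c) = \<zero>"
  using commutator_swap[of _ "\<phi> c"]
  by (simp_all add: commutator_mult_right commutator_mult_left commutator_scalar_generators)

text \<open>The second Leibniz term vanishes by the last premise, which
  \<open>commutator_scalar\<close> and \<open>commutator_scalar_generators\<close> discharge for the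
  words that occur.\<close>

lemma commutator_scalar_mult_left:
  "\<lbrakk>x \<in> carrier R; y \<in> carrier R; commutator R (\<phi> c) y = \<zero>\<rbrakk>
    \<Longrightarrow> commutator R (\<phi> c \<otimes> x) y = \<phi> c \<otimes> commutator R x y"
  by (simp add: commutator_mult_left)

lemma commutator_scalar_mult_right:
  "\<lbrakk>x \<in> carrier R; y \<in> carrier R; commutator R x (\<phi> c) = \<zero>\<rbrakk>
    \<Longrightarrow> commutator R x (\<phi> c \<otimes> y) = \<phi> c \<otimes> commutator R x y"
  by (simp add: commutator_mult_right)

lemmas bilinear_simps = commutator_add_left commutator_add_right commutator_scalar_mult_left
  commutator_scalar_mult_right commutator_scalar commutator_scalar_generators

text \<open>The conditions on the coefficients, including the quadratic equation in \<open>x\<close>, are solved for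
  \<open>e0\<close>, \<open>e2\<close>, \<open>e3\<close>, \<open>e4\<close> and \<open>x3\<close>, so that no division occurs.\<close>

lemma embedding_relations:
  assumes "e4 = - 2 * x2" and "x3 = e1 - 2 * x2 * x + x2" and "e3 = e1 - e4 * x0"
    and "e2 = e4 * (x - x\<^sup>2) + e1 * (1 - 2 * x) - 2 * x5"
    and "e0 = x5 - e1 * x0 + e2 - k * x2"
    and Z: "Z = p \<ominus> \<one>"
    and X: "X = \<ominus> (a \<otimes> p) \<oplus> a \<oplus> \<phi> x \<otimes> p \<oplus> \<phi> x0 \<otimes> \<one>"
    and V: "V = \<phi> x2 \<otimes> (a [^] (2::nat)) \<oplus> \<phi> x3 \<otimes> a \<oplus> \<phi> x2 \<otimes> m \<oplus> \<phi> x5 \<otimes> \<one>"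
  shows "commutator R Z X = Z [^] (2::nat) \<oplus> Z"
    and "commutator R X V =
      anticommutator R V Z \<oplus> \<phi> e1 \<otimes> X \<oplus> V \<oplus> \<phi> e2 \<otimes> Z \<oplus> \<phi> e0 \<otimes> \<one>"
    and "commutator R V Z = \<phi> e4 \<otimes> X \<oplus> \<phi> e1 \<otimes> Z \<oplus> \<phi> e3 \<otimes> \<one>"
proof -
  \<comment> \<open>Each element is prepared twice: as a sum of words, for bilinear expansion of
    brackets, and as a \<open>lin_comb\<close>, for comparing coefficients.\<close>
  have Z': "Z = p \<oplus> \<phi> (- 1)"
    by (simp add: Z minus_eq scalar_minus scalar_one)
  have X': "X = \<phi> (- 1) \<otimes> (a \<otimes> p) \<oplus> a \<oplus> \<phi> x \<otimes> p \<oplus> \<phi> x0"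
    by (simp add: X uminus_eq_scalar)
  have V': "V = \<phi> x2 \<otimes> (a \<otimes> a) \<oplus> \<phi> x3 \<otimes> a \<oplus> \<phi> x2 \<otimes> m \<oplus> \<phi> x5"
    by (simp add: V numeral_2_eq_2)
  have ZN: "Z = lin_comb 0 0 1 0 0 0 (- 1)"
    by (simp add: Z' lin_comb_def scalar_zero scalar_one)
  have XN: "X = lin_comb 0 (- 1) x 0 1 0 x0"
    by (simp add: X' lin_comb_def scalar_zero scalar_one a_ac)
  have VN: "V = lin_comb 0 0 0 x2 x3 x2 x5"
    by (simp add: V' lin_comb_def scalar_zero scalar_one a_ac)
  have pV: "commutator R p V = lin_comb 0 (- 2 * x2) (x2 - x3) 0 (2 * x2) 0 0"
    by (simp add: V' bilinear_simps commutators_words commutators_generators lin_comb_scalar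
        lin_comb_add mult.commute)
  \<comment> \<open>\<open>Z\<close> and \<open>p\<close> differ by a scalar, which commutes with
    \<open>V\<close>.\<close>
  have VZ: "commutator R V Z = \<ominus> commutator R p V"
  proof -
    have "commutator R V (\<phi> (- 1)) = \<zero>"
      using commutator_swap[of "V" "\<phi> (- 1)"] by (simp add: V' bilinear_simps)
    then show ?thesis
      using commutator_swap[of V p] by (simp add: Z' VN commutator_add_right)
  qed
  then show "commutator R V Z = \<phi> e4 \<otimes> X \<oplus> \<phi> e1 \<otimes> Z \<oplus> \<phi> e3 \<otimes> \<one>"
    by (simp add: pV XN ZN lin_comb_add_scalar lin_comb_scalar lin_comb_add lin_comb_uminus assms(1-3)
        algebra_simps)
  have XV: "commutator R X V =
      lin_comb (2 * x2) (x3 - x2 - 2 * x2 * x) (x * (x2 - x3)) (- 3 * x2) (2 * x2 * x - x2) (- x2)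
        (k * x2)"
    by (simp add: X' V' bilinear_simps commutators_words commutators_generators lin_comb_scalar
        lin_comb_add lin_comb_zero algebra_simps)
  have Vp: "V \<otimes> p = lin_comb x2 x3 x5 (- x2) (- x2) 0 (k * x2)"
    by (simp add: VN lin_comb_mult)
  \<comment> \<open>Writing pV = Vp + [p,V] leaves only a right multiplication by \<open>p\<close>,
    which keeps \<open>V\<close> within the seven words.\<close>
  have "anticommutator R V Z = V \<otimes> p \<oplus> V \<otimes> p \<oplus> commutator R p V \<oplus> \<phi> (- 2) \<otimes> V"
  proof -
    have "p \<otimes> V = V \<otimes> p \<oplus> commutator R p V"
      by (simp add: commutator_def minus_eq VN a_ac r_neg1 r_neg2 r_neg)
    moreover have "V \<otimes> \<phi> (- 1) = \<phi> (- 1) \<otimes> V"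
      by (simp add: VN scalar_minus scalar_one l_minus r_minus)
    moreover have "\<phi> (- 2) \<otimes> V = \<phi> (- 1) \<otimes> V \<oplus> \<phi> (- 1) \<otimes> V"
      by (simp add: VN lin_comb_scalar lin_comb_add)
    ultimately show ?thesis
      by (simp add: anticommutator_def Z' VN l_distr r_distr a_ac)
  qed
  then have "anticommutator R V Z =
      lin_comb (2 * x2) (2 * x3 - 2 * x2) (x2 - x3 + 2 * x5) (- 4 * x2) (- 2 * x3)
        (- 2 * x2) (2 * k * x2 - 2 * x5)"
    unfolding Vp pV by (simp add: VN lin_comb_scalar lin_comb_add algebra_simps)
  then show "commutator R X V =
      anticommutator R V Z \<oplus> \<phi> e1 \<otimes> X \<oplus> V \<oplus> \<phi> e2 \<otimes> Z \<oplus> \<phi> e0 \<otimes> \<one>"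
    \<comment> \<open>The brackets are rewritten while \<open>X\<close>, \<open>V\<close> and
      \<open>Z\<close> are still opaque; only then are the remaining occurrences expanded. The
      coefficient of \<open>p\<close> gives the condition on \<open>e2\<close>, and the constant
      coefficient gives the one on \<open>e0\<close>, where the quadratic equation enters.\<close>
    by (simp add: XV, simp add: XN VN ZN lin_comb_add_scalar lin_comb_scalar lin_comb_add assms(1-5)
        algebra_simps power2_eq_square)
  \<comment> \<open>Here \<open>p \<otimes> p\<close> appears, so the computation is direct: [Z,X] =
    pp - p = Zp = Z(Z + 1).\<close>
  have "commutator R Z X = \<phi> (- 1) \<otimes> commutator R p (a \<otimes> p) \<oplus> commutator R p a"
    by (simp add: Z' X' bilinear_simps commutator_self)
  also have "\<dots> = Z \<otimes> p"
    using commutator_swap[of p a]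
    by (simp add: Z commutators_words commutator_a_p scalar_minus scalar_one l_minus l_distr
        minus_eq)
  also have "\<dots> = Z \<otimes> (Z \<oplus> \<one>)"
    by (simp add: Z minus_eq a_assoc l_neg)
  also have "\<dots> = Z [^] (2::nat) \<oplus> Z"
    by (simp add: ZN r_distr numeral_2_eq_2)
  finally show "commutator R Z X = Z [^] (2::nat) \<oplus> Z" .
qed

end

section \<open>The extension of \<open>U(sl\<^sub>2)\<close>\<close>

lemma (in ring_hom_ring) hom_commutator:
  "\<lbrakk>a \<in> carrier R; b \<in> carrier R\<rbrakk> \<Longrightarrow> h (commutator R a b) = commutator S (h a) (h b)"
  by (simp add: commutator_def a_minus_def)

lemma (in ideal) quotient_central:
  assumes "z \<in> carrier R" and "\<And>y. y \<in> carrier R \<Longrightarrow> z \<otimes> y = y \<otimes> z"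
    and "Y \<in> carrier (R Quot I)"
  shows "(I +> z) \<otimes>\<^bsub>R Quot I\<^esub> Y = Y \<otimes>\<^bsub>R Quot I\<^esub> (I +> z)"
proof -
  obtain y where "y \<in> carrier R" "Y = I +> y"
    using assms(3) unfolding FactRing_def A_RCOSETS_def'[of R I] by auto
  then show ?thesis
    using assms(1,2) by (simp flip: ring_hom_mult[OF rcos_ring_hom])
qed

lemma (in UP_ring) monom_central:
  assumes "z \<in> carrier R" and "\<And>y. y \<in> carrier R \<Longrightarrow> z \<otimes> y = y \<otimes> z" and "f \<in> carrier P"
  shows "monom P z 0 \<otimes>\<^bsub>P\<^esub> f = f \<otimes>\<^bsub>P\<^esub> monom P z 0"
proof (rule up_eqI)
  fix n
  \<comment> \<open>A constant polynomial leaves only the term \<open>i = n\<close> of the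
    convolution sum.\<close>
  have "coeff P (f \<otimes>\<^bsub>P\<^esub> monom P z 0) n = (\<Oplus>i \<in> {..n}. if n = i then coeff P f i \<otimes> z else \<zero>)"
    using assms by (auto intro!: R.finsum_cong')
  also have "\<dots> = z \<otimes> coeff P f n"
    using assms R.finsum_singleton[of n "{..n}" "\<lambda>i. coeff P f i \<otimes> z"] by simp
  finally show "coeff P (monom P z 0 \<otimes>\<^bsub>P\<^esub> f) n = coeff P (f \<otimes>\<^bsub>P\<^esub> monom P z 0) n"
    using assms by (simp add: monom_mult_is_smult del: coeff_mult)
qed (use assms in simp_all)

lemma free_scalar_central: "free_scalar c * f = f * free_scalar c"
proof (induction f rule: update_induct)
  case (update f w b)
  \<comment> \<open>The new word \<open>w\<close> is outside the support of \<open>f\<close>, so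
    updating is adding a monomial.\<close>
  have "Poly_Mapping.update w b f = f + Poly_Mapping.single w b"
    using update.hyps by (intro poly_mapping_eqI)
      (auto simp: lookup_update lookup_add lookup_single in_keys_iff when_def)
  then show ?case
    using update.IH
    by (simp add: distrib_left distrib_right free_scalar_def mult_single mult.commute)
qed simp

text \<open>Centrality is passed along the construction: from the free algebra to its quotient, to
  constant polynomials, and to the final quotient.\<close>

lemma ext_scalar_central:
  assumes "y \<in> carrier (U_ext \<eta>)"
  shows "ext_scalar \<eta> c \<otimes>\<^bsub>U_ext \<eta>\<^esub> y = y \<otimes>\<^bsub>U_ext \<eta>\<^esub> ext_scalar \<eta> c"
proof -
  interpret P: UP_ring U_sl2 "UP U_sl2" by (rule UP_ring_U) simp
  have "U_scalar c \<otimes>\<^bsub>U_sl2\<^esub> u = u \<otimes>\<^bsub>U_sl2\<^esub> U_scalar c" if "u \<in> carrier U_sl2" for u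
    using that unfolding U_sl2_def U_scalar_def
    by (intro ideal.quotient_central[OF sl2_ideal_ideal])
      (auto simp: free_alg_def free_scalar_central)
  then have "monom (UP U_sl2) (U_scalar c) 0 \<otimes>\<^bsub>UP U_sl2\<^esub> f
      = f \<otimes>\<^bsub>UP U_sl2\<^esub> monom (UP U_sl2) (U_scalar c) 0" if "f \<in> carrier (UP U_sl2)" for f
    using that by (intro P.monom_central) (auto simp: U_scalar_closed)
  then show ?thesis
    using assms unfolding U_ext_def ext_scalar_def ext_of_U_def
    by (intro ideal.quotient_central[OF ext_ideal_ideal]) (auto simp: U_scalar_closed)
qed

text \<open>Going from the free algebra to the extension in one homomorphism lets scalars and
  defining relations be handled in the free algebra.\<close>

definition free_to_ext :: "(nat \<Rightarrow> complex) \<Rightarrow> sl2_free \<Rightarrow> U_poly set"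
  where "free_to_ext \<eta> f = ext_of_U \<eta> (sl2_ideal +>\<^bsub>free_alg\<^esub> f)"

lemma free_to_ext_hom: "free_to_ext \<eta> \<in> ring_hom free_alg (U_ext \<eta>)"
  using ring_hom_trans[OF ideal.rcos_ring_hom[OF sl2_ideal_ideal, folded U_sl2_def] ext_of_U_hom]
  by (simp add: free_to_ext_def[abs_def] comp_def)

lemma free_to_ext_eq:
  "free_to_ext \<eta> (free_gen g) = ext_gen \<eta> g" "free_to_ext \<eta> (free_scalar c) = ext_scalar \<eta> c"
  by (simp_all add: free_to_ext_def ext_gen_def ext_scalar_def U_gen_def U_scalar_def)

lemma free_to_ext_zero:
  assumes "f \<in> sl2_ideal"
  shows "free_to_ext \<eta> f = \<zero>\<^bsub>U_ext \<eta>\<^esub>"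
proof -
  interpret I: ideal sl2_ideal free_alg by (rule sl2_ideal_ideal)
  interpret h: ring_hom_ring U_sl2 "U_ext \<eta>" "ext_of_U \<eta>"
    by (rule ring_hom_ringI2[OF U_sl2_ring U_ext_ring ext_of_U_hom])
  have "sl2_ideal +>\<^bsub>free_alg\<^esub> f = \<zero>\<^bsub>U_sl2\<^esub>"
    using assms I.a_coset_join2[OF I.Icarr[OF assms] I.a_subgroup]
    by (simp add: U_sl2_def FactRing_def)
  then show ?thesis by (simp add: free_to_ext_def)
qed

lemma scalar_hom_ext_scalar: "scalar_hom (U_ext \<eta>) (ext_scalar \<eta>)"
proof -
  interpret f: ring_hom_ring free_alg "U_ext \<eta>" "free_to_ext \<eta>"
    by (rule ring_hom_ringI2[OF free_alg_ring U_ext_ring free_to_ext_hom])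
  show ?thesis
  proof
    fix c d
    show "ext_scalar \<eta> c \<in> carrier (U_ext \<eta>)"
      using f.hom_closed[of "free_scalar c"] by (simp add: free_to_ext_eq free_alg_def)
    show "ext_scalar \<eta> (c + d) = ext_scalar \<eta> c \<oplus>\<^bsub>U_ext \<eta>\<^esub> ext_scalar \<eta> d"
      using f.hom_add[of "free_scalar c" "free_scalar d"]
      by (simp add: free_alg_def flip: free_to_ext_eq) (simp add: free_scalar_def single_add)
    show "ext_scalar \<eta> (c * d) = ext_scalar \<eta> c \<otimes>\<^bsub>U_ext \<eta>\<^esub> ext_scalar \<eta> d"
      using f.hom_mult[of "free_scalar c" "free_scalar d"]
      by (simp add: free_alg_def flip: free_to_ext_eq) (simp add: free_scalar_def mult_single)
    show "ext_scalar \<eta> 1 = \<one>\<^bsub>U_ext \<eta>\<^esub>"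
      using f.hom_one by (simp add: free_alg_def free_scalar_def flip: free_to_ext_eq)
  qed
qed

lemma ext_gen_closed: "ext_gen \<eta> g \<in> carrier (U_ext \<eta>)"
  unfolding ext_gen_def by (rule ring_hom_closed[OF ext_of_U_hom U_gen_closed])

text \<open>The three relators generate \<open>sl2_ideal\<close>, so \<open>free_to_ext\<close>
  sends them to zero.\<close>

lemma ext_gen_relations:
  "commutator (U_ext \<eta>) (ext_gen \<eta> Gen0) (ext_gen \<eta> GenPlus) = ext_gen \<eta> GenPlus"
  "commutator (U_ext \<eta>) (ext_gen \<eta> Gen0) (ext_gen \<eta> GenMinus)
    = \<ominus>\<^bsub>U_ext \<eta>\<^esub> ext_gen \<eta> GenMinus"
  "commutator (U_ext \<eta>) (ext_gen \<eta> GenPlus) (ext_gen \<eta> GenMinus)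
    = ext_scalar \<eta> 2 \<otimes>\<^bsub>U_ext \<eta>\<^esub> ext_gen \<eta> Gen0"
proof -
  interpret F: ring free_alg by (rule free_alg_ring)
  interpret f: ring_hom_ring free_alg "U_ext \<eta>" "free_to_ext \<eta>"
    by (rule ring_hom_ringI2[OF free_alg_ring U_ext_ring free_to_ext_hom])
  have [simp]: "u \<in> carrier free_alg" for u
    by (simp add: free_alg_def)
  \<comment> \<open>The relators mix type class operations with those of the ring record; the
    homomorphism laws need the latter.\<close>
  have free_add: "u + v = u \<oplus>\<^bsub>free_alg\<^esub> v" and free_mult: "u * v = u \<otimes>\<^bsub>free_alg\<^esub> v" for u v
    by (simp_all add: free_alg_def)
  have free_uminus: "- u = \<ominus>\<^bsub>free_alg\<^esub> u" for u
    by (rule F.minus_equality[symmetric]) (simp_all add: free_alg_def)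
  have free_diff: "u - v = u \<oplus>\<^bsub>free_alg\<^esub> \<ominus>\<^bsub>free_alg\<^esub> v" for u v
    unfolding diff_conv_add_uminus free_add free_uminus ..
  have rel: "free_to_ext \<eta> u = \<zero>\<^bsub>U_ext \<eta>\<^esub>"
    if "u \<in> {commutator free_alg (free_gen Gen0) (free_gen GenPlus) - free_gen GenPlus,
     commutator free_alg (free_gen Gen0) (free_gen GenMinus) + free_gen GenMinus,
     commutator free_alg (free_gen GenPlus) (free_gen GenMinus)
       - free_scalar 2 * free_gen Gen0}" for u
    by (rule free_to_ext_zero, unfold sl2_ideal_def, rule subsetD[OF F.genideal_self that])
      (simp only: subsetI \<open>\<And>u. u \<in> carrier free_alg\<close>)
  have "free_to_ext \<eta> (commutator free_alg (free_gen Gen0) (free_gen GenPlus)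
      - free_gen GenPlus) = \<zero>\<^bsub>U_ext \<eta>\<^esub>"
    by (rule rel) simp
  then show "commutator (U_ext \<eta>) (ext_gen \<eta> Gen0) (ext_gen \<eta> GenPlus) = ext_gen \<eta> GenPlus"
    by (simp add: free_diff f.hom_commutator free_to_ext_eq ext_gen_closed f.S.commutator_closed
        flip: f.S.minus_eq)
  have "free_to_ext \<eta> (commutator free_alg (free_gen Gen0) (free_gen GenMinus)
      + free_gen GenMinus) = \<zero>\<^bsub>U_ext \<eta>\<^esub>"
    by (rule rel) simp
  then show "commutator (U_ext \<eta>) (ext_gen \<eta> Gen0) (ext_gen \<eta> GenMinus)
      = \<ominus>\<^bsub>U_ext \<eta>\<^esub> ext_gen \<eta> GenMinus"
    by (intro f.S.minus_equality[symmetric])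
      (simp_all add: free_add f.hom_commutator free_to_ext_eq ext_gen_closed f.S.commutator_closed)
  have "free_to_ext \<eta> (commutator free_alg (free_gen GenPlus) (free_gen GenMinus)
      - free_scalar 2 * free_gen Gen0) = \<zero>\<^bsub>U_ext \<eta>\<^esub>"
    by (rule rel) simp
  then show "commutator (U_ext \<eta>) (ext_gen \<eta> GenPlus) (ext_gen \<eta> GenMinus)
      = ext_scalar \<eta> 2 \<otimes>\<^bsub>U_ext \<eta>\<^esub> ext_gen \<eta> Gen0"
    using scalar_hom.scalar_closed[OF scalar_hom_ext_scalar]
    by (simp add: free_diff free_mult f.hom_commutator free_to_ext_eq ext_gen_closed
        f.S.commutator_closed flip: f.S.minus_eq)
qed

theorem proposition7p1:
  fixes \<eta> :: "nat \<Rightarrow> complex" and E (structure) and s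
    and J\<^sub>0 J\<^sub>p J\<^sub>m C \<xi>\<^sub>0 \<xi>\<^sub>1 \<xi>\<^sub>2 \<xi>\<^sub>3 \<xi>\<^sub>4 \<xi>\<^sub>5 Z X V
  assumes "\<eta> 4 \<noteq> 0"
    and "E = U_ext \<eta>"
    and "s = ext_scalar \<eta>"
    and "J\<^sub>0 = ext_gen \<eta> Gen0"
    and "J\<^sub>p = ext_gen \<eta> GenPlus"
    and "J\<^sub>m = ext_gen \<eta> GenMinus"
    and "C = casimir E J\<^sub>0 J\<^sub>p J\<^sub>m"
    and "\<xi>\<^sub>1 \<in> carrier E"
    and "commutator E \<xi>\<^sub>1 J\<^sub>0 = \<zero>" and "commutator E \<xi>\<^sub>1 J\<^sub>p = \<zero>" and "commutator E \<xi>\<^sub>1 J\<^sub>m = \<zero>"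
    and "s (- (\<eta> 4)\<^sup>2) \<otimes> (\<xi>\<^sub>1 [^] (2::nat))
      \<oplus> s (\<eta> 4 * (\<eta> 4 - 2 * \<eta> 1)) \<otimes> \<xi>\<^sub>1
      \<oplus> s (- 2 * (\<eta> 1)\<^sup>2 + 2 * \<eta> 1 * \<eta> 3 - 2 * \<eta> 0 * \<eta> 4 + \<eta> 4 * \<eta> 1 + \<eta> 2 * \<eta> 4)
      \<oplus> s ((\<eta> 4)\<^sup>2) \<otimes> C = \<zero>"
    and "\<xi>\<^sub>0 = s ((\<eta> 1 - \<eta> 3) / \<eta> 4)"
    and "\<xi>\<^sub>2 = s (- \<eta> 4 / 2)"
    and "\<xi>\<^sub>4 = s (- \<eta> 4 / 2)"
    and "\<xi>\<^sub>3 = s (\<eta> 1) \<oplus> s (\<eta> 4) \<otimes> (\<xi>\<^sub>1 \<ominus> s (1 / 2))"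
    and "\<xi>\<^sub>5 = s (1 / 2) \<otimes>
      (s (\<eta> 4) \<otimes> (\<xi>\<^sub>1 \<ominus> \<xi>\<^sub>1 [^] (2::nat)) \<oplus> s (\<eta> 1) \<otimes> (\<one> \<ominus> s 2 \<otimes> \<xi>\<^sub>1) \<ominus> s (\<eta> 2))"
    and "Z = J\<^sub>p \<ominus> \<one>"
    and "X = \<ominus> (J\<^sub>0 \<otimes> J\<^sub>p) \<oplus> J\<^sub>0 \<oplus> \<xi>\<^sub>1 \<otimes> J\<^sub>p \<oplus> \<xi>\<^sub>0 \<otimes> \<one>"
    and "V = \<xi>\<^sub>2 \<otimes> (J\<^sub>0 [^] (2::nat)) \<oplus> \<xi>\<^sub>3 \<otimes> J\<^sub>0 \<oplus> \<xi>\<^sub>4 \<otimes> J\<^sub>m \<oplus> \<xi>\<^sub>5 \<otimes> \<one>"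
  shows "commutator E Z X = Z [^] (2::nat) \<oplus> Z
    \<and> commutator E X V =
        anticommutator E V Z \<oplus> s (\<eta> 1) \<otimes> X \<oplus> V \<oplus> s (\<eta> 2) \<otimes> Z \<oplus> s (\<eta> 0) \<otimes> \<one>
    \<and> commutator E V Z = s (\<eta> 4) \<otimes> X \<oplus> s (\<eta> 1) \<otimes> Z \<oplus> s (\<eta> 3) \<otimes> \<one>"
proof -
  interpret s: scalar_hom E s
    unfolding assms(2,3) by (rule scalar_hom_ext_scalar)
  have s_central: "s c \<otimes> y = y \<otimes> s c" if "y \<in> carrier E" for c y
    using that unfolding assms(2,3) by (rule ext_scalar_central)
  interpret ev: scalar_hom_eval E s \<xi>\<^sub>1
    by unfold_locales (use assms(8) s_central in simp_all)
  \<comment> \<open>From here on the scalars are polynomials, and the indeterminate \<open>t\<close>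
    stands for the given root \<open>\<xi>\<^sub>1\<close>.\<close>
  define \<phi> where "\<phi> = s.eval_poly \<xi>\<^sub>1"
  interpret \<phi>: scalar_hom E \<phi>
    unfolding \<phi>_def by (rule ev.scalar_hom_eval_poly)
  have const: "\<phi> [:c:] = s c" for c
    by (simp add: \<phi>_def)
  define t :: "complex poly" where "t = [:0, 1:]"
  have var: "\<phi> t = \<xi>\<^sub>1"
    using assms(8) by (simp add: \<phi>_def t_def s.scalar_zero s.scalar_one)
  have J: "J\<^sub>0 \<in> carrier E" "J\<^sub>p \<in> carrier E" "J\<^sub>m \<in> carrier E"
    unfolding assms by (rule ext_gen_closed)+
  have C: "C \<in> carrier E"
    using J by (simp add: assms(7) casimir_def)
  have commutes: "y \<otimes> \<phi> f = \<phi> f \<otimes> y" if "y \<in> {J\<^sub>0, J\<^sub>p, J\<^sub>m}" for y f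
  proof -
    have "y \<in> carrier E" "\<xi>\<^sub>1 \<otimes> y = y \<otimes> \<xi>\<^sub>1"
      using that assms(8-11) J s.commutator_eq_zero_iff by auto
    then show ?thesis
      unfolding \<phi>_def using ev.eval_poly_commutes s_central by metis
  qed
  \<comment> \<open>The quadratic equation without its Casimir term. It then reads \<open>\<phi> q
    \<oplus> s ((\<eta> 4)\<^sup>2) \<otimes> C = \<zero>\<close>, and dividing by the nonzero
    number \<open>(\<eta> 4)\<^sup>2\<close> gives C as the value of \<open>k\<close>.\<close>
  define q where "q = [:- (\<eta> 4)\<^sup>2:] * (t * t) + [:\<eta> 4 * (\<eta> 4 - 2 * \<eta> 1):] * t
    + [:- 2 * (\<eta> 1)\<^sup>2 + 2 * \<eta> 1 * \<eta> 3 - 2 * \<eta> 0 * \<eta> 4 + \<eta> 4 * \<eta> 1 + \<eta> 2 * \<eta> 4:]"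
  define k where "k = [:1 / (\<eta> 4)\<^sup>2:] * (- q)"
  have square: "y [^] (2::nat) = y \<otimes> y" if "y \<in> carrier E" for y
    using that by (simp add: numeral_2_eq_2)
  have "\<phi> q \<oplus> s ((\<eta> 4)\<^sup>2) \<otimes> C = \<zero>"
    using assms(12) unfolding q_def square[OF assms(8)]
    by (simp only: \<phi>.scalar_add \<phi>.scalar_mult const var)
  then have "s ((\<eta> 4)\<^sup>2) \<otimes> C = \<phi> (- q)"
    using C s.minus_equality[of "s ((\<eta> 4)\<^sup>2) \<otimes> C" "\<phi> q"]
    by (simp add: \<phi>.scalar_minus s.a_comm)
  then have "\<phi> k = s (1 / (\<eta> 4)\<^sup>2) \<otimes> (s ((\<eta> 4)\<^sup>2) \<otimes> C)"
    by (simp only: k_def \<phi>.scalar_mult const)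
  also have "\<dots> = s (1 / (\<eta> 4)\<^sup>2 * (\<eta> 4)\<^sup>2) \<otimes> C"
    using C by (simp only: s.scalar_mult s.m_assoc s.scalar_closed)
  also have "\<dots> = C"
    using C assms(1) by (simp add: s.scalar_one)
  finally have C_eq: "C = \<phi> k" ..
  interpret sl2_triple E \<phi> J\<^sub>0 J\<^sub>p J\<^sub>m k
  proof
    show "commutator E J\<^sub>0 J\<^sub>p = J\<^sub>p" "commutator E J\<^sub>0 J\<^sub>m = \<ominus> J\<^sub>m"
      unfolding assms(2-6) by (rule ext_gen_relations)+
    have "commutator E J\<^sub>p J\<^sub>m = s 2 \<otimes> J\<^sub>0"
      unfolding assms(2-6) by (rule ext_gen_relations)
    then show "commutator E J\<^sub>p J\<^sub>m = \<phi> 2 \<otimes> J\<^sub>0"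
      using const[of 2] by (simp add: numeral_poly)
    show "casimir E J\<^sub>0 J\<^sub>p J\<^sub>m = \<phi> k"
      using C_eq assms(7) by simp
  qed (use J commutes in auto)
  \<comment> \<open>Polynomial preimages of the coefficients; \<open>x2\<close> represents both
    \<open>\<xi>\<^sub>2\<close> and \<open>\<xi>\<^sub>4\<close>.\<close>
  define x0 where "x0 = [:(\<eta> 1 - \<eta> 3) / \<eta> 4:]"
  define x2 where "x2 = [:- \<eta> 4 / 2:]"
  define x3 where "x3 = [:\<eta> 1:] + [:\<eta> 4:] * (t - [:1 / 2:])"
  define x5 where "x5 = [:1 / 2:] *
    ([:\<eta> 4:] * (t - t * t) + [:\<eta> 1:] * (1 - [:2:] * t) - [:\<eta> 2:])"
  have \<xi>: "\<xi>\<^sub>0 = \<phi> x0" "\<xi>\<^sub>2 = \<phi> x2" "\<xi>\<^sub>4 = \<phi> x2" "\<xi>\<^sub>3 = \<phi> x3" "\<xi>\<^sub>5 = \<phi> x5"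
    unfolding assms(13-17) x0_def x2_def x3_def x5_def square[OF assms(8)]
    by (simp_all only: \<phi>.scalar_add \<phi>.scalar_mult \<phi>.scalar_diff \<phi>.scalar_one const var)
  note rels = embedding_relations[where x = t and ?x0.0 = x0 and ?x2.0 = x2 and ?x3.0 = x3
      and ?x5.0 = x5 and ?e0.0 = "[:\<eta> 0:]" and ?e1.0 = "[:\<eta> 1:]" and ?e2.0 = "[:\<eta> 2:]"
      and ?e3.0 = "[:\<eta> 3:]" and ?e4.0 = "[:\<eta> 4:]" and Z = Z and X = X and V = V,
      unfolded const var, folded \<xi>]
  \<comment> \<open>These are identities of polynomials in the indeterminate \<open>t\<close>: the
    quadratic equation has already been absorbed into \<open>k\<close>, so expansion proves
    them.\<close>
  have coeffs: "[:\<eta> 4:] = - 2 * x2" "x3 = [:\<eta> 1:] - 2 * x2 * t + x2"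
    "[:\<eta> 3:] = [:\<eta> 1:] - [:\<eta> 4:] * x0"
    "[:\<eta> 2:] = [:\<eta> 4:] * (t - t\<^sup>2) + [:\<eta> 1:] * (1 - 2 * t) - 2 * x5"
    "[:\<eta> 0:] = x5 - [:\<eta> 1:] * x0 + [:\<eta> 2:] - k * x2"
    using assms(1)
    by (simp_all add: x0_def x2_def x3_def x5_def k_def q_def t_def numeral_poly power2_eq_square
        one_pCons field_simps del: pCons_one)
  show ?thesis
    using rels[OF coeffs] assms(18-20) \<xi> by simp
qed

end
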